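(* Let $m,p$ be positive integers and let $a,b,x$ be real numbers with $|a|=|b|>1$ and $|x|<|a|^{-1}=|b|^{-1}$. Then \[\begin{aligned} &(-1)^p\sum_{n=1}^\infty\frac{\zeta_n(2;ax)\,\zeta_n(m;b)}{a^nn^p}-(-1)^m\sum_{n=1}^\infty\frac{\zeta_n(2;bx)\,\zeta_n(p;a)}{b^nn^m}\\ &=\sum_{i=1}^{p-1}\sum_{j=1}^{p-i}(-1)^{i+j}\mathrm{Li}_{p+2-i-j}(ax)\,\mathrm{Li}_{i+j,m}(x,b)-\sum_{i=1}^{m-1}\sum_{j=1}^{m-i}(-1)^{i+j}\mathrm{Li}_{m+2-i-j}(bx)\,\mathrm{Li}_{i+j,p}(x,a)\\ &\quad+(-1)^pp\ln(1-ax)\left(\mathrm{Li}_{p+1,m}(x,b)-\mathrm{Li}_{p+1,m}(a^{-1},b)\right)\\ &\quad-(-1)^mm\ln(1-bx)\left(\mathrm{Li}_{m+1,p}(x,a)-\mathrm{Li}_{m+1,p}(b^{-1},a)\right)\\ &\quad-(-1)^pp\sum_{n=1}^\infty\frac{\zeta_n(1;ax)\,\zeta_n(m;b)}{a^nn^{p+1}}+(-1)^mm\sum_{n=1}^\infty\frac{\zeta_n(1;bx)\,\zeta_n(p;a)}{b^nn^{m+1}}\\ &\quad+(-1)^p\mathrm{Li}_2(ax)\,\mathrm{Li}_{p,m}(a^{-1},b)-(-1)^m\mathrm{Li}_2(bx)\,\mathrm{Li}_{m,p}(b^{-1},a). \end{aligned}\]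
   Context: For positive integers $n,m$ and $c\in\mathbb C$, $\zeta_n(m;c)=\sum_{k=1}^n c^k/k^m$. $\mathrm{Li}_p(t)=\sum_{n\ge1}t^n/n^p$. For positive integers $s,t$, $\mathrm{Li}_{s,t}(u,v)=\sum_{n=1}^\infty\frac{u^n}{n^s}\sum_{k=1}^n\frac{v^k}{k^t}$, for those real $u,v$ for which the outer series converges (all instances in the statement converge). Empty sums are $0$. *)

theory Defs
  imports "HOL-Analysis.Analysis"
begin

text \<open>The type is kept general so that the parameter may be real or complex.\<close>

definition zeta_sum :: "nat \<Rightarrow> nat \<Rightarrow> 'a::real_normed_field \<Rightarrow> 'a" where
  "zeta_sum n m c = (\<Sum>k=1..n. c ^ k / of_nat k ^ m)"

text \<open>All infinite series start at index 1, hence the shift by \<open>Suc\<close>. As always with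
  \<open>suminf\<close>, values are meaningful only where the series converges.\<close>

definition Li :: "nat \<Rightarrow> real \<Rightarrow> real" where
  "Li p t = (\<Sum>n. t ^ Suc n / real (Suc n) ^ p)"

definition Li2 :: "nat \<Rightarrow> nat \<Rightarrow> real \<Rightarrow> real \<Rightarrow> real" where
  "Li2 s t u v = (\<Sum>n. u ^ Suc n / real (Suc n) ^ s * (\<Sum>k=1..Suc n. v ^ k / real k ^ t))"

end

theory Submission
  imports Defs
begin

text \<open>Completing the finite sums \<open>\<zeta>\<^sub>n(2;ax)\<close> and \<open>\<zeta>\<^sub>n(1;ax)\<close> to \<open>Li\<^sub>2(ax)\<close> and \<open>-ln(1 - ax)\<close>
  leaves tails \<open>\<Sum>\<^sub>k (ax)\<^sup>n\<^sup>+\<^sup>k/(n+k)\<^sup>2\<close> and \<open>\<Sum>\<^sub>k (ax)\<^sup>n\<^sup>+\<^sup>k/(n+k)\<close>.  The partial fraction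
  decomposition of \<open>1/(k\<^sup>p (n+k)\<^sup>2)\<close> in \<open>k\<close> combines these tails with the products of
  polylogarithms, so that the terms attached to \<open>(a,p)\<close> on the two sides differ exactly by
  \<open>\<Sum>\<^sub>n\<^sub>,\<^sub>k \<zeta>\<^sub>n(m;b) x\<^sup>n (ax)\<^sup>k/(k\<^sup>p (n+k)\<^sup>2)\<close>.  With \<open>N = n+k\<close> this is
  \<open>\<Sum>\<^sub>N x\<^sup>N/N\<^sup>2 \<Sum> (a\<^sup>k/k\<^sup>p) (b\<^sup>j/j\<^sup>m)\<close>, the inner sum over \<open>j, k \<ge> 1\<close> with \<open>j + k \<le> N\<close>,
  which is symmetric under exchanging \<open>(a,p)\<close> and \<open>(b,m)\<close>.\<close>

section \<open>Partial fractions and the triangular double sum\<close>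

text \<open>The coefficients \<open>(-1) ^ r * real (Suc r)\<close> are those of the Taylor
  expansion of \<open>1 / (n + k)\<^sup>2\<close> at \<open>k = 0\<close>; the last two terms are
  the principal part at the double pole \<open>k = -n\<close>. The induction divides by
  \<open>k\<close> once per step.\<close>

lemma partial_fraction_inverse_square:
  fixes k n :: real
  assumes "k > 0" "n > 0"
  shows "1 / (k ^ p * (n + k)\<^sup>2) =
    (\<Sum>r<p. (-1) ^ r * real (Suc r) / (k ^ (p - r) * n ^ (r + 2)))
    + (-1) ^ p / (n ^ p * (n + k)\<^sup>2) + (-1) ^ p * real p / (n ^ (p + 1) * (n + k))"
proof (induction p)
  case 0
  show ?case by simp
next
  case (Suc p)
  have nz: "k \<noteq> 0" "n \<noteq> 0" "n + k \<noteq> 0"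
    using assms by auto
  have sum_div: "(\<Sum>r<p. (-1) ^ r * real (Suc r) / (k ^ (p - r) * n ^ (r + 2))) / k
      = (\<Sum>r<p. (-1) ^ r * real (Suc r) / (k ^ (Suc p - r) * n ^ (r + 2)))"
    unfolding sum_divide_distrib by (rule sum.cong) (auto simp: Suc_diff_le)
  have one: "1 / (n + k) / k = 1 / (n * k) - 1 / (n * (n + k))"
    using nz by (simp add: divide_simps)
  have two: "1 / (n + k)\<^sup>2 / k = 1 / (n\<^sup>2 * k) - 1 / (n\<^sup>2 * (n + k)) - 1 / (n * (n + k)\<^sup>2)"
    using nz by (simp add: divide_simps power2_eq_square)
  have "1 / (k ^ Suc p * (n + k)\<^sup>2) = 1 / (k ^ p * (n + k)\<^sup>2) / k"
    by simp
  also have "\<dots> = (\<Sum>r<p. (-1) ^ r * real (Suc r) / (k ^ (p - r) * n ^ (r + 2))) / k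
      + (-1) ^ p / n ^ p * (1 / (n + k)\<^sup>2 / k)
      + (-1) ^ p * real p / n ^ (p + 1) * (1 / (n + k) / k)"
    unfolding Suc.IH by (simp add: add_divide_distrib)
  \<comment> \<open>The \<open>1 / k\<close> parts of \<open>one\<close> and \<open>two\<close>,
    with weights \<open>p\<close> and 1, form the new summand \<open>r = p\<close>; the simple poles
    at \<open>k = -n\<close> add up to weight \<open>p + 1\<close> in the same way.\<close>
  also have "\<dots> = (\<Sum>r<p. (-1) ^ r * real (Suc r) / (k ^ (Suc p - r) * n ^ (r + 2)))
      + (-1) ^ p * real (Suc p) / (k * n ^ (p + 2))
      + (-1) ^ Suc p / (n ^ Suc p * (n + k)\<^sup>2)
      + (-1) ^ Suc p * real (Suc p) / (n ^ (Suc p + 1) * (n + k))"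
    unfolding one two sum_div using nz
    by (simp add: algebra_simps power2_eq_square add_divide_distrib diff_divide_distrib)
  finally show ?case by simp
qed

text \<open>The diagonal \<open>i + j = r + 2\<close> of the triangle contains \<open>r + 1\<close>
  pairs. This matches the double sums of the theorem with the coefficients \<open>r + 1\<close> of
  the partial fractions.\<close>

lemma sum_triangle_by_index_sum:
  fixes g :: "nat \<Rightarrow> real"
  shows "(\<Sum>i=1..q. \<Sum>j=1..Suc q - i. g (i + j)) = (\<Sum>r<q. real (Suc r) * g (r + 2))"
proof (induction q)
  case 0
  show ?case by simp
next
  case (Suc q)
  have "(\<Sum>j=1..Suc (Suc q) - i. g (i + j)) = (\<Sum>j=1..Suc q - i. g (i + j)) + g (q + 2)"
    if "i \<in> {1..Suc q}" for i
    using that by (simp add: Suc_diff_le)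
  then have "(\<Sum>i=1..Suc q. \<Sum>j=1..Suc (Suc q) - i. g (i + j))
      = (\<Sum>i=1..Suc q. (\<Sum>j=1..Suc q - i. g (i + j)) + g (q + 2))"
    by (rule sum.cong[OF refl])
  also have "\<dots> = (\<Sum>i=1..q. \<Sum>j=1..Suc q - i. g (i + j)) + real (Suc q) * g (q + 2)"
    by (simp add: sum.distrib)
  finally show ?case
    using Suc.IH by simp
qed

section \<open>Polylogarithms and their tails\<close>

lemma summable_Li:
  fixes y :: real
  assumes "\<bar>y\<bar> < 1"
  shows "summable (\<lambda>k. y ^ Suc k / real (Suc k) ^ s)"
proof (rule summable_comparison_test)
  show "\<exists>N. \<forall>k\<ge>N. norm (y ^ Suc k / real (Suc k) ^ s) \<le> \<bar>y\<bar> ^ Suc k"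
  proof (intro exI allI impI)
    fix k
    have "1 \<le> real (Suc k) ^ s" by (rule one_le_power) simp
    then show "norm (y ^ Suc k / real (Suc k) ^ s) \<le> \<bar>y\<bar> ^ Suc k"
      by (simp add: power_abs divide_le_eq mult_le_cancel_left1 flip: power_Suc del: power_Suc of_nat_Suc)
  qed
  show "summable (\<lambda>k. \<bar>y\<bar> ^ Suc k)"
    using assms summable_geometric[of "\<bar>y\<bar>"] by (subst summable_Suc_iff) simp
qed

lemma Li_1:
  assumes "\<bar>y\<bar> < 1"
  shows "Li 1 y = - ln (1 - y)"
proof -
  have "(\<lambda>n. y ^ n / real n) sums - ln (1 - y)"
    using sums_minus[OF ln_series'[of "- y"]] assms by simp
  then have "(\<lambda>n. y ^ Suc n / real (Suc n)) sums - ln (1 - y)"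
    \<comment> \<open>Dropping index 0 changes nothing, since
      \<open>y ^ 0 / real 0 = 0\<close>.\<close>
    by (subst sums_Suc_iff) simp
  then show ?thesis
    unfolding Li_def by (simp add: sums_iff)
qed

text \<open>The tail of the polylogarithm series beyond index \<open>Suc n\<close>. Dividing by
  \<open>y ^ Suc n\<close> leaves the weight \<open>y ^ Suc k\<close>, the one under which the
  partial fractions are summed.\<close>

lemma sums_Li_tail:
  assumes "\<bar>y\<bar> < 1"
  shows "(\<lambda>k. y ^ Suc k / real (Suc n + Suc k) ^ s) sums
    ((Li s y - zeta_sum (Suc n) s y) / y ^ Suc n)"
proof (cases "y = 0")
  \<comment> \<open>All terms vanish, and the claimed value is a division by zero, hence 0.\<close>
  case True
  then show ?thesis by simp
next
  case False
  let ?f = "\<lambda>k. y ^ Suc k / real (Suc k) ^ s"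
  have "(\<lambda>k. ?f (k + Suc n)) sums (Li s y - (\<Sum>i<Suc n. ?f i))"
    using summable_sums[OF summable_Li[OF assms, of s]]
    unfolding Li_def by (subst sums_iff_shift) simp
  also have "(\<Sum>i<Suc n. ?f i) = zeta_sum (Suc n) s y"
    unfolding zeta_sum_def by (rule sum.reindex_bij_witness[of _ "\<lambda>i. i - 1" Suc]) auto
  finally have "(\<lambda>k. ?f (k + Suc n) / y ^ Suc n) sums
      ((Li s y - zeta_sum (Suc n) s y) / y ^ Suc n)"
    by (rule sums_divide)
  moreover have "?f (k + Suc n) / y ^ Suc n = y ^ Suc k / real (Suc n + Suc k) ^ s" for k
    using False by (simp add: power_add algebra_simps)
  ultimately show ?thesis by simp
qed

text \<open>Summing the partial fractions over \<open>k\<close>: the poles at 0 produce full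
  polylogarithms, the poles at \<open>-Suc n\<close> the tails of \<open>Li 2\<close> and
  \<open>Li 1\<close>.\<close>

lemma sums_partial_fraction:
  assumes "\<bar>y\<bar> < 1"
  shows "(\<lambda>k. y ^ Suc k / (real (Suc k) ^ p * real (Suc n + Suc k) ^ 2)) sums
    ((\<Sum>r<p. (-1) ^ r * real (Suc r) * Li (p - r) y / real (Suc n) ^ (r + 2))
     + (-1) ^ p / real (Suc n) ^ p * ((Li 2 y - zeta_sum (Suc n) 2 y) / y ^ Suc n)
     + (-1) ^ p * real p / real (Suc n) ^ (p + 1) * ((Li 1 y - zeta_sum (Suc n) 1 y) / y ^ Suc n))"
proof -
  have eq: "y ^ Suc k / (real (Suc k) ^ p * real (Suc n + Suc k) ^ 2) =
      (\<Sum>r<p. (-1) ^ r * real (Suc r) / real (Suc n) ^ (r + 2) * (y ^ Suc k / real (Suc k) ^ (p - r)))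
      + (-1) ^ p / real (Suc n) ^ p * (y ^ Suc k / real (Suc n + Suc k) ^ 2)
      + (-1) ^ p * real p / real (Suc n) ^ (p + 1) * (y ^ Suc k / real (Suc n + Suc k) ^ 1)" for k
  proof -
    have "y ^ Suc k / (real (Suc k) ^ p * real (Suc n + Suc k) ^ 2)
        = y ^ Suc k * (1 / (real (Suc k) ^ p * (real (Suc n) + real (Suc k))\<^sup>2))"
      by simp
    also have "\<dots> = y ^ Suc k *
       ((\<Sum>r<p. (-1) ^ r * real (Suc r) / (real (Suc k) ^ (p - r) * real (Suc n) ^ (r + 2)))
       + (-1) ^ p / (real (Suc n) ^ p * (real (Suc n) + real (Suc k))\<^sup>2)
       + (-1) ^ p * real p / (real (Suc n) ^ (p + 1) * (real (Suc n) + real (Suc k))))"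
      by (subst partial_fraction_inverse_square) simp_all
    also have "\<dots> = (\<Sum>r<p. (-1) ^ r * real (Suc r) / real (Suc n) ^ (r + 2) * (y ^ Suc k / real (Suc k) ^ (p - r)))
      + (-1) ^ p / real (Suc n) ^ p * (y ^ Suc k / real (Suc n + Suc k) ^ 2)
      + (-1) ^ p * real p / real (Suc n) ^ (p + 1) * (y ^ Suc k / real (Suc n + Suc k) ^ 1)"
      unfolding distrib_left sum_distrib_left of_nat_add power_one_right
      by (intro arg_cong2[where f = "(+)"] sum.cong refl) (simp_all add: algebra_simps del: of_nat_Suc)
    finally show ?thesis .
  qed
  have Li: "(\<lambda>k. y ^ Suc k / real (Suc k) ^ s) sums Li s y" for s
    using summable_sums[OF summable_Li[OF assms]] unfolding Li_def .
  have "(\<lambda>k. y ^ Suc k / (real (Suc k) ^ p * real (Suc n + Suc k) ^ 2)) sums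
    ((\<Sum>r<p. (-1) ^ r * real (Suc r) / real (Suc n) ^ (r + 2) * Li (p - r) y)
     + (-1) ^ p / real (Suc n) ^ p * ((Li 2 y - zeta_sum (Suc n) 2 y) / y ^ Suc n)
     + (-1) ^ p * real p / real (Suc n) ^ (p + 1) * ((Li 1 y - zeta_sum (Suc n) 1 y) / y ^ Suc n))"
    unfolding eq by (intro sums_add sums_sum sums_mult Li sums_Li_tail assms)
  then show ?thesis by simp
qed

section \<open>Convergence of the single series\<close>

lemma abs_zeta_sum_le:
  fixes c :: real
  shows "\<bar>zeta_sum n s c\<bar> \<le> zeta_sum n s \<bar>c\<bar>"
  unfolding zeta_sum_def by (rule order_trans[OF sum_abs]) (simp add: power_abs)

lemma zeta_sum_antimono:
  fixes c :: real
  assumes "c \<ge> 0" "s \<le> t"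
  shows "zeta_sum n t c \<le> zeta_sum n s c"
  unfolding zeta_sum_def
  using assms by (intro sum_mono divide_left_mono power_increasing) auto

text \<open>Since \<open>1 / (j * n) \<le> 1 / j\<^sup>2\<close> for \<open>j \<le> n\<close>, the series is dominated by the Cauchy product
  of \<open>\<Sum> 1 / j\<^sup>2\<close> with a geometric series.\<close>

lemma summable_zeta_sum_div_power:
  fixes c :: real
  assumes "c > 1"
  shows "summable (\<lambda>n. zeta_sum (Suc n) 1 c / (c ^ Suc n * real (Suc n)))"
proof (rule summable_comparison_test')
  have "summable (\<lambda>i. 1 / real (Suc i) ^ 2)"
    using inverse_power_summable[of 2, where 'a = real]
    by (subst summable_Suc_iff) (simp add: inverse_eq_divide)
  moreover have "summable (\<lambda>i. (1 / c) ^ i)"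
    using assms by (intro summable_geometric) simp
  ultimately show "summable (\<lambda>n. \<Sum>i\<le>n. 1 / real (Suc i) ^ 2 * (1 / c) ^ (n - i))"
    using assms by (intro summable_Cauchy_product) simp_all
  fix n :: nat
  have "zeta_sum (Suc n) 1 c / (c ^ Suc n * real (Suc n))
      = (\<Sum>i\<le>n. c ^ Suc i / real (Suc i) / (c ^ Suc n * real (Suc n)))"
    unfolding zeta_sum_def sum_divide_distrib
    by (rule sum.reindex_bij_witness[of _ Suc "\<lambda>i. i - 1"]) auto
  also have "\<dots> \<le> (\<Sum>i\<le>n. 1 / real (Suc i) ^ 2 * (1 / c) ^ (n - i))"
  proof (rule sum_mono)
    fix i assume "i \<in> {..n}"
    then have i: "i \<le> n" by simp
    have "c ^ Suc n = c ^ Suc i * c ^ (n - i)"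
      using i by (simp flip: power_add power_Suc)
    then have "c ^ Suc i / real (Suc i) / (c ^ Suc n * real (Suc n))
        = 1 / (real (Suc i) * real (Suc n)) * (1 / c) ^ (n - i)"
      using assms by (simp add: power_one_over divide_simps del: of_nat_Suc power_Suc)
    also have "\<dots> \<le> 1 / real (Suc i) ^ 2 * (1 / c) ^ (n - i)"
      using i assms unfolding power2_eq_square
      by (intro mult_right_mono divide_left_mono mult_left_mono mult_pos_pos) auto
    finally show "c ^ Suc i / real (Suc i) / (c ^ Suc n * real (Suc n))
        \<le> 1 / real (Suc i) ^ 2 * (1 / c) ^ (n - i)" .
  qed
  finally show "norm (zeta_sum (Suc n) 1 c / (c ^ Suc n * real (Suc n)))
      \<le> (\<Sum>i\<le>n. 1 / real (Suc i) ^ 2 * (1 / c) ^ (n - i))"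
    using assms by (simp add: zeta_sum_def sum_nonneg)
qed

text \<open>Covers both kinds of series: \<open>w = 1\<close> gives \<open>Li2\<close>, and a
  bounded \<open>zeta_sum\<close> as \<open>w\<close> gives the series with two finite sums. The
  worst case \<open>m = s = 1\<close>, \<open>\<bar>u\<bar> = 1 / \<bar>b\<bar>\<close> is the
  majorant; this endpoint is attained by \<open>u = inverse a\<close>.\<close>

lemma summable_zeta_sum_weighted:
  fixes b u :: real
  assumes "\<bar>b\<bar> > 1" "\<bar>u\<bar> \<le> 1 / \<bar>b\<bar>" "m \<ge> 1" "s \<ge> 1"
    and w: "\<And>n. \<bar>w n\<bar> \<le> C"
  shows "summable (\<lambda>n. w n * (zeta_sum (Suc n) m b * u ^ Suc n / real (Suc n) ^ s))"
proof (rule summable_comparison_test')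
  let ?g = "\<lambda>n. zeta_sum (Suc n) 1 \<bar>b\<bar> / (\<bar>b\<bar> ^ Suc n * real (Suc n))"
  show "summable (\<lambda>n. C * ?g n)"
    using assms by (intro summable_mult summable_zeta_sum_div_power)
  fix n :: nat
  have z: "\<bar>zeta_sum (Suc n) m b\<bar> \<le> zeta_sum (Suc n) 1 \<bar>b\<bar>"
    using assms by (intro order_trans[OF abs_zeta_sum_le] zeta_sum_antimono) auto
  have u: "\<bar>u\<bar> ^ Suc n \<le> (1 / \<bar>b\<bar>) ^ Suc n"
    using assms by (intro power_mono) auto
  have "real (Suc n) ^ 1 \<le> real (Suc n) ^ s"
    using assms by (intro power_increasing) auto
  then have "1 / real (Suc n) ^ s \<le> 1 / real (Suc n)"
    by (intro divide_left_mono) auto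
  then have "\<bar>zeta_sum (Suc n) m b\<bar> * \<bar>u\<bar> ^ Suc n * (1 / real (Suc n) ^ s)
      \<le> zeta_sum (Suc n) 1 \<bar>b\<bar> * (1 / \<bar>b\<bar>) ^ Suc n * (1 / real (Suc n))"
    using z u by (intro mult_mono mult_nonneg_nonneg) auto
  also have "\<dots> = ?g n"
    by (simp add: power_one_over)
  finally have "\<bar>w n\<bar> * (\<bar>zeta_sum (Suc n) m b\<bar> * \<bar>u\<bar> ^ Suc n * (1 / real (Suc n) ^ s)) \<le> C * ?g n"
    using w[of n] by (intro mult_mono) auto
  then show "norm (w n * (zeta_sum (Suc n) m b * u ^ Suc n / real (Suc n) ^ s)) \<le> C * ?g n"
    by (simp add: abs_mult power_abs del: power_Suc of_nat_Suc)
qed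

text \<open>A bound uniform in \<open>n\<close>, so that these finite sums can act as the weight
  \<open>w\<close> above.\<close>

lemma abs_zeta_sum_le_Li:
  assumes "\<bar>y\<bar> < (1::real)"
  shows "\<bar>zeta_sum (Suc n) s y\<bar> \<le> Li s \<bar>y\<bar>"
proof -
  have "zeta_sum (Suc n) s \<bar>y\<bar> = (\<Sum>i<Suc n. \<bar>y\<bar> ^ Suc i / real (Suc i) ^ s)"
    unfolding zeta_sum_def by (rule sum.reindex_bij_witness[of _ Suc "\<lambda>i. i - 1"]) auto
  also have "\<dots> \<le> Li s \<bar>y\<bar>"
    unfolding Li_def using assms by (intro sum_le_suminf summable_Li) auto
  finally show ?thesis
    using abs_zeta_sum_le[of "Suc n" s y] by linarith
qed

section \<open>The symmetric triple sum\<close>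

text \<open>All indices are shifted by one. With \<open>N = Suc n + Suc k\<close>, the region
  \<open>j \<le> n\<close> is \<open>Suc j + Suc k \<le> N\<close>; nesting \<open>(n, k)\<close>
  makes it a \<open>Sigma\<close> with finite fibres.\<close>

definition triple_term :: "real \<Rightarrow> nat \<Rightarrow> real \<Rightarrow> nat \<Rightarrow> real \<Rightarrow> (nat \<times> nat) \<times> nat \<Rightarrow> real" where
  "triple_term x p a m b = (\<lambda>((n, k), j). x ^ (Suc n + Suc k) / real (Suc n + Suc k) ^ 2
     * (a ^ Suc k / real (Suc k) ^ p) * (b ^ Suc j / real (Suc j) ^ m))"

text \<open>Dropping denominators and using
  \<open>\<bar>b\<bar> ^ Suc j \<le> \<bar>b\<bar> ^ Suc n\<close> with
  \<open>\<bar>a\<bar> = \<bar>b\<bar>\<close> bounds the term by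
  \<open>q ^ Suc n * q ^ Suc k\<close> for \<open>q = \<bar>x * a\<bar>\<close>. The
  \<open>n + 1\<close> values of \<open>j\<close> add a factor \<open>Suc n\<close>, leaving a
  geometric series times its derivative series.\<close>

lemma triple_term_summable:
  assumes "\<bar>a\<bar> = \<bar>b\<bar>" "\<bar>x * a\<bar> < 1" "\<bar>b\<bar> > 1"
  shows "triple_term x p a m b summable_on Sigma UNIV (\<lambda>(n, k). {..n})"
proof -
  define q where "q = \<bar>x * a\<bar>"
  have q: "0 \<le> q" "q < 1" using assms by (auto simp: q_def)
  have G: "(\<lambda>k. q ^ Suc k) summable_on UNIV"
    using q summable_geometric[of q]
    by (subst summable_on_UNIV_nonneg_real_iff) (auto simp: summable_Suc_iff simp del: power_Suc)
  have "summable (\<lambda>n. real (Suc n) * q ^ n * q)"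
    using geometric_deriv_sums[of q] q by (intro summable_mult2) (auto simp: sums_iff)
  then have D: "(\<lambda>n. real (Suc n) * q ^ Suc n) summable_on UNIV"
    using q by (subst summable_on_UNIV_nonneg_real_iff) (auto simp: mult_ac)
  have "(\<lambda>(n, k). real (Suc n) * q ^ Suc n * q ^ Suc k) summable_on UNIV \<times> UNIV"
  proof (rule summable_on_SigmaI)
    show "((\<lambda>k. case (n, k) of (n, k) \<Rightarrow> real (Suc n) * q ^ Suc n * q ^ Suc k) has_sum
        real (Suc n) * q ^ Suc n * infsum (\<lambda>k. q ^ Suc k) UNIV) UNIV" for n
      unfolding prod.case by (intro has_sum_cmult_right has_sum_infsum G)
    show "(\<lambda>n. real (Suc n) * q ^ Suc n * infsum (\<lambda>k. q ^ Suc k) UNIV) summable_on UNIV"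
      by (intro summable_on_cmult_left D)
  qed (use q in auto)
  then have outer: "(\<lambda>(n, k). real (Suc n) * q ^ Suc n * q ^ Suc k) summable_on UNIV"
    by simp
  have dom: "(\<lambda>((n, k), j). q ^ Suc n * q ^ Suc k) summable_on Sigma UNIV (\<lambda>(n, k). {..n})"
  proof (rule summable_on_SigmaI[OF _ outer])
    fix nk :: "nat \<times> nat"
    obtain n k where nk: "nk = (n, k)" by fastforce
    show "((\<lambda>j. (\<lambda>((n, k), j). q ^ Suc n * q ^ Suc k) (nk, j)) has_sum
        (case nk of (n, k) \<Rightarrow> real (Suc n) * q ^ Suc n * q ^ Suc k)) (case nk of (n, k) \<Rightarrow> {..n})"
      unfolding nk prod.case by (rule has_sum_finiteI) auto
  qed (use q in auto)
  have "(\<lambda>t. norm (triple_term x p a m b t)) summable_on Sigma UNIV (\<lambda>(n, k). {..n})"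
  proof (rule Infinite_Sum.abs_summable_on_comparison_test'[OF dom])
    fix t :: "(nat \<times> nat) \<times> nat" assume "t \<in> Sigma UNIV (\<lambda>(n, k). {..n})"
    then obtain n k j where t: "t = ((n, k), j)" and j: "j \<le> n" by (cases t) auto
    have ge1: "1 \<le> real (Suc i) ^ s" for i s by (rule one_le_power) simp
    have frac: "z / real (Suc i) ^ s \<le> z" if "z \<ge> 0" for z i s
      using that ge1[of i s] by (simp add: divide_le_eq mult_le_cancel_left1 del: of_nat_Suc)
    have "norm (triple_term x p a m b t)
        = \<bar>x\<bar> ^ (Suc n + Suc k) / real (Suc (Suc n + k)) ^ 2
     * (\<bar>a\<bar> ^ Suc k / real (Suc k) ^ p) * (\<bar>b\<bar> ^ Suc j / real (Suc j) ^ m)"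
      unfolding t triple_term_def prod.case real_norm_def abs_mult abs_divide power_abs by simp
    also have "\<dots> \<le> \<bar>x\<bar> ^ (Suc n + Suc k) * \<bar>a\<bar> ^ Suc k * \<bar>b\<bar> ^ Suc n"
    proof (intro mult_mono frac order_trans[OF frac])
      show "\<bar>b\<bar> ^ Suc j \<le> \<bar>b\<bar> ^ Suc n"
        using assms j by (intro power_increasing) auto
    qed auto
    also have "\<dots> = q ^ Suc n * q ^ Suc k"
      unfolding q_def abs_mult assms(1) power_add power_mult_distrib by (simp add: mult_ac)
    finally show "norm (triple_term x p a m b t) \<le> (\<lambda>((n, k), j). q ^ Suc n * q ^ Suc k) t"
      unfolding t prod.case .
  qed
  then show ?thesis by (rule abs_summable_summable)
qed

text \<open>The reindexing keeps \<open>n + k\<close>, hence \<open>N\<close>, and exchanges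
  \<open>k\<close> with \<open>j\<close>. It is an involution of the region, because
  \<open>k \<le> n + k - j\<close> is equivalent to \<open>j \<le> n\<close> and the subtraction
  never truncates there.\<close>

lemma infsum_triple_term_swap:
  "infsum (triple_term x p a m b) (Sigma UNIV (\<lambda>(n, k). {..n}))
   = infsum (triple_term x m b p a) (Sigma UNIV (\<lambda>(n, k). {..n}))"
  by (rule infsum_reindex_bij_witness[where i = "\<lambda>((n, k), j). ((n + k - j, j), k)"
        and j = "\<lambda>((n, k), j). ((n + k - j, j), k)"])
     (auto simp: triple_term_def mult_ac)

text \<open>Iterated summation in the order \<open>j\<close>, \<open>k\<close>, \<open>n\<close>:
  the finite sum over \<open>j\<close> is \<open>zeta_sum (Suc n) m b\<close>, and the series over
  \<open>k\<close> is the one evaluated by \<open>sums_partial_fraction\<close>.\<close>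

lemma sums_infsum_triple_term:
  assumes "\<bar>a\<bar> = \<bar>b\<bar>" "\<bar>x * a\<bar> < 1" "\<bar>b\<bar> > 1"
  shows "(\<lambda>n. zeta_sum (Suc n) m b * x ^ Suc n *
      (\<Sum>k. (a * x) ^ Suc k / (real (Suc k) ^ p * real (Suc n + Suc k) ^ 2))) sums
    infsum (triple_term x p a m b) (Sigma UNIV (\<lambda>(n, k). {..n}))"
proof -
  define f where "f = (\<lambda>(n, k). zeta_sum (Suc n) m b * x ^ Suc n *
      ((a * x) ^ Suc k / (real (Suc k) ^ p * real (Suc n + Suc k) ^ 2)))"
  note S = triple_term_summable[OF assms, of p m]
  have f: "infsum (\<lambda>j. triple_term x p a m b (nk, j)) (case nk of (n, k) \<Rightarrow> {..n}) = f nk" for nk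
  proof -
    obtain n k where nk: "nk = (n, k)" by fastforce
    have "zeta_sum (Suc n) m b = (\<Sum>j\<le>n. b ^ Suc j / real (Suc j) ^ m)"
      unfolding zeta_sum_def by (rule sum.reindex_bij_witness[of _ Suc "\<lambda>i. i - 1"]) auto
    moreover have "infsum (\<lambda>j. triple_term x p a m b (nk, j)) (case nk of (n, k) \<Rightarrow> {..n})
        = x ^ Suc n * x ^ Suc k / real (Suc n + Suc k) ^ 2 * (a ^ Suc k / real (Suc k) ^ p)
          * (\<Sum>j\<le>n. b ^ Suc j / real (Suc j) ^ m)"
      unfolding nk triple_term_def prod.case power_add sum_distrib_left by (rule infsum_finite) simp
    ultimately show ?thesis
      unfolding nk f_def prod.case power_mult_distrib by (simp add: mult_ac)
  qed
  have "infsum (triple_term x p a m b) (Sigma UNIV (\<lambda>(n, k). {..n})) = infsum f UNIV"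
    using infsum_Sigma_banach[OF S] unfolding f by simp
  moreover have "(\<lambda>nk. infsum (\<lambda>j. triple_term x p a m b (nk, j)) (case nk of (n, k) \<Rightarrow> {..n}))
      summable_on UNIV"
    by (rule summable_on_Sigma_banach) (use S in simp)
  then have F: "f summable_on UNIV \<times> UNIV" by (simp add: f)
  moreover have "infsum f UNIV = infsum (\<lambda>n. infsum (\<lambda>k. f (n, k)) UNIV) UNIV"
    using infsum_Sigma_banach[OF F] by simp
  moreover have "(\<lambda>n. infsum (\<lambda>k. f (n, k)) UNIV) summable_on UNIV"
    using summable_on_Sigma_banach[of "\<lambda>n k. f (n, k)"] F by (simp add: case_prod_unfold)
  moreover have "infsum (\<lambda>k. f (n, k)) UNIV = zeta_sum (Suc n) m b * x ^ Suc n *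
      (\<Sum>k. (a * x) ^ Suc k / (real (Suc k) ^ p * real (Suc n + Suc k) ^ 2))" for n
  proof -
    have s: "summable (\<lambda>k. (a * x) ^ Suc k / (real (Suc k) ^ p * real (Suc n + Suc k) ^ 2))"
      using sums_partial_fraction[of "a * x" p n] assms by (auto simp: sums_iff mult_ac)
    have "(\<lambda>k. f (n, k)) summable_on UNIV"
      by (rule summable_on_SigmaD1[where f = "\<lambda>n k. f (n, k)" and A = UNIV and B = "\<lambda>_. UNIV"])
        (use F in simp_all)
    then have "infsum (\<lambda>k. f (n, k)) UNIV = (\<Sum>k. f (n, k))"
      by (intro sums_unique has_sum_imp_sums has_sum_infsum)
    then show ?thesis
      unfolding f_def prod.case using suminf_mult[OF s] by simp
  qed
  ultimately show ?thesis
    by (metis (no_types, lifting) has_sum_imp_sums has_sum_infsum infsum_cong summable_on_cong)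
qed

section \<open>Evaluation of the triple sum and conclusion\<close>

text \<open>Half of the theorem: the partial fractions are summed over \<open>n\<close> term by
  term, and the result is solved for the series containing
  \<open>zeta_sum (Suc n) 2 (a * x)\<close>.\<close>

lemma zeta_sum_series_reduction:
  fixes a b x :: real
  assumes "p \<ge> 1" "m \<ge> 1" "\<bar>a\<bar> = \<bar>b\<bar>" "\<bar>a\<bar> > 1" "\<bar>x\<bar> < inverse \<bar>a\<bar>"
  shows "(-1) ^ p * (\<Sum>n. zeta_sum (Suc n) 2 (a * x) * zeta_sum (Suc n) m b
            / (a ^ Suc n * real (Suc n) ^ p))
    = (\<Sum>i=1..p-1. \<Sum>j=1..p-i. (-1) ^ (i + j) * Li (p + 2 - i - j) (a * x) * Li2 (i + j) m x b)
      + (-1) ^ p * real p * ln (1 - a * x) * (Li2 (p + 1) m x b - Li2 (p + 1) m (inverse a) b)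
      - (-1) ^ p * real p * (\<Sum>n. zeta_sum (Suc n) 1 (a * x) * zeta_sum (Suc n) m b
            / (a ^ Suc n * real (Suc n) ^ (p + 1)))
      + (-1) ^ p * Li 2 (a * x) * Li2 p m (inverse a) b
      - infsum (triple_term x p a m b) (Sigma UNIV (\<lambda>(n, k). {..n}))"
proof -
  define y where "y = a * x"
  have "\<bar>a * x\<bar> < 1"
    using assms by (simp add: abs_mult field_simps)
  then have y: "\<bar>y\<bar> < 1" "\<bar>x * a\<bar> < 1"
    by (simp_all add: y_def mult.commute)
  have b: "\<bar>b\<bar> > 1" and a0: "a \<noteq> 0"
    using assms by auto
  have xb: "\<bar>x\<bar> \<le> 1 / \<bar>b\<bar>" and ab: "\<bar>inverse a\<bar> \<le> 1 / \<bar>b\<bar>"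
    using assms by (simp_all add: inverse_eq_divide)
  define c where "c = (\<lambda>n. zeta_sum (Suc n) m b)"
  \<comment> \<open>\<open>h u s\<close> is the summand of \<open>Li2 s m u b\<close>; every series
    below is a combination of such summands, possibly weighted by a finite sum in
    \<open>y\<close>.\<close>
  define h where "h = (\<lambda>u s n. c n * u ^ Suc n / real (Suc n) ^ s)"
  have Li2: "h u s sums Li2 s m u b" if "\<bar>u\<bar> \<le> 1 / \<bar>b\<bar>" "s \<ge> 1" for u s
  proof -
    have "summable (h u s)"
      using summable_zeta_sum_weighted[OF b that(1) \<open>m \<ge> 1\<close> that(2), of "\<lambda>_. 1" 1]
      by (simp add: h_def c_def)
    moreover have "Li2 s m u b = suminf (h u s)"
      unfolding Li2_def h_def c_def zeta_sum_def by (simp add: mult_ac)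
    ultimately show ?thesis by (simp add: summable_sums)
  qed
  define Z where "Z = (\<lambda>t s. \<Sum>n. zeta_sum (Suc n) t y * c n / (a ^ Suc n * real (Suc n) ^ s))"
  have Z: "(\<lambda>n. zeta_sum (Suc n) t y * h (inverse a) s n) sums Z t s" if "s \<ge> 1" for t s
  proof -
    have "summable (\<lambda>n. zeta_sum (Suc n) t y * h (inverse a) s n)"
      unfolding h_def c_def
      by (rule summable_zeta_sum_weighted[OF b ab \<open>m \<ge> 1\<close> that abs_zeta_sum_le_Li[OF y(1)]])
    moreover have "zeta_sum (Suc n) t y * h (inverse a) s n
        = zeta_sum (Suc n) t y * c n / (a ^ Suc n * real (Suc n) ^ s)" for n
      unfolding h_def power_inverse by (simp add: divide_inverse mult_ac)
    ultimately show ?thesis unfolding Z_def by (simp add: summable_sums)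
  qed
  \<comment> \<open>The quotient \<open>x ^ Suc n / (a * x) ^ Suc n\<close> is the source of the
    argument \<open>inverse a\<close>. For \<open>x = 0\<close> nothing cancels, but the difference
    \<open>Li s y - zeta_sum (Suc n) s y\<close> is itself 0.\<close>
  have x_pow: "x ^ Suc n * ((Li s y - zeta_sum (Suc n) s y) / y ^ Suc n)
      = inverse a ^ Suc n * (Li s y - zeta_sum (Suc n) s y)" for n s
  proof (cases "x = 0")
    case True
    then have "Li s y - zeta_sum (Suc n) s y = 0"
      unfolding y_def Li_def zeta_sum_def by (auto intro!: sum.neutral)
    then show ?thesis by (simp add: True)
  next
    case False
    then show ?thesis
      using a0 unfolding y_def power_mult_distrib power_inverse by (simp add: divide_simps)
  qed
  have inner: "zeta_sum (Suc n) m b * x ^ Suc n *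
        (\<Sum>k. (a * x) ^ Suc k / (real (Suc k) ^ p * real (Suc n + Suc k) ^ 2))
      = (\<Sum>r<p. (-1) ^ r * real (Suc r) * Li (p - r) y * h x (r + 2) n)
        + (-1) ^ p * (Li 2 y * h (inverse a) p n - zeta_sum (Suc n) 2 y * h (inverse a) p n)
        + (-1) ^ p * real p * (Li 1 y * h (inverse a) (p + 1) n
            - zeta_sum (Suc n) 1 y * h (inverse a) (p + 1) n)" (is "?L = ?R") for n
  proof -
    have "?L = c n * x ^ Suc n * (\<Sum>r<p. (-1) ^ r * real (Suc r) * Li (p - r) y / real (Suc n) ^ (r + 2))
      + (-1) ^ p / real (Suc n) ^ p * c n * (x ^ Suc n * ((Li 2 y - zeta_sum (Suc n) 2 y) / y ^ Suc n))
      + (-1) ^ p * real p / real (Suc n) ^ (p + 1) * c n * (x ^ Suc n * ((Li 1 y - zeta_sum (Suc n) 1 y) / y ^ Suc n))"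
      unfolding c_def sums_unique[OF sums_partial_fraction[OF y(1), of p n, unfolded y_def], symmetric] y_def
      by (simp add: distrib_left mult_ac del: power_Suc of_nat_Suc)
    also have "\<dots> = ?R"
      unfolding x_pow h_def sum_distrib_left
      by (intro arg_cong2[where f = "(+)"] sum.cong refl) (simp_all add: algebra_simps del: power_Suc of_nat_Suc)
    finally show ?thesis .
  qed
  have "(\<lambda>n. ?R n) sums
      ((\<Sum>r<p. (-1) ^ r * real (Suc r) * Li (p - r) y * Li2 (r + 2) m x b)
        + (-1) ^ p * (Li 2 y * Li2 p m (inverse a) b - Z 2 p)
        + (-1) ^ p * real p * (Li 1 y * Li2 (p + 1) m (inverse a) b - Z 1 (p + 1)))"
    using \<open>p \<ge> 1\<close> by (intro sums_add sums_sum sums_mult sums_diff Li2 Z xb ab) simp_all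
  then have T: "infsum (triple_term x p a m b) (Sigma UNIV (\<lambda>(n, k). {..n}))
      = (\<Sum>r<p. (-1) ^ r * real (Suc r) * Li (p - r) y * Li2 (r + 2) m x b)
        + (-1) ^ p * (Li 2 y * Li2 p m (inverse a) b - Z 2 p)
        + (-1) ^ p * real p * (Li 1 y * Li2 (p + 1) m (inverse a) b - Z 1 (p + 1))"
    using sums_infsum_triple_term[OF assms(3) y(2) b, of m p] unfolding inner
    by (rule sums_unique2[rotated])
  \<comment> \<open>The summand \<open>r = p - 1\<close> carries \<open>Li 1 y\<close>, which is
    \<open>- ln (1 - y)\<close>, and supplies the \<open>Li2 (p + 1) m x b\<close> part of the
    logarithmic term. The other \<open>q\<close> summands form the triangular double sum.\<close>
  obtain q where q: "p = Suc q"
    using \<open>p \<ge> 1\<close> by (cases p) auto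
  have "(\<Sum>i=1..p-1. \<Sum>j=1..p-i. (-1) ^ (i + j) * Li (p + 2 - i - j) y * Li2 (i + j) m x b)
      = (\<Sum>r<q. real (Suc r) * ((-1) ^ (r + 2) * Li (p + 2 - (r + 2)) y * Li2 (r + 2) m x b))"
    using sum_triangle_by_index_sum[of "\<lambda>N. (-1) ^ N * Li (p + 2 - N) y * Li2 N m x b" q]
    by (simp add: q)
  moreover have "(\<Sum>r<p. (-1) ^ r * real (Suc r) * Li (p - r) y * Li2 (r + 2) m x b)
      = (\<Sum>r<q. real (Suc r) * ((-1) ^ (r + 2) * Li (p + 2 - (r + 2)) y * Li2 (r + 2) m x b))
        - (-1) ^ p * real p * Li 1 y * Li2 (p + 1) m x b"
    unfolding q by (simp add: mult_ac)
  ultimately show ?thesis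
    using T unfolding Z_def c_def y_def[symmetric] Li_1[OF y(1)]
    by (simp add: algebra_simps)
qed

theorem theorem3p5:
  fixes m p :: nat and a b x :: real
  assumes "m \<ge> 1" and "p \<ge> 1"
    and "\<bar>a\<bar> = \<bar>b\<bar>" and "\<bar>a\<bar> > 1"
    and "\<bar>x\<bar> < inverse \<bar>a\<bar>"
  shows
    "(-1) ^ p * (\<Sum>n. zeta_sum (Suc n) 2 (a * x) * zeta_sum (Suc n) m b
                        / (a ^ Suc n * real (Suc n) ^ p))
     - (-1) ^ m * (\<Sum>n. zeta_sum (Suc n) 2 (b * x) * zeta_sum (Suc n) p a
                        / (b ^ Suc n * real (Suc n) ^ m))
     = (\<Sum>i=1..p-1. \<Sum>j=1..p-i.
          (-1) ^ (i + j) * Li (p + 2 - i - j) (a * x) * Li2 (i + j) m x b)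
     - (\<Sum>i=1..m-1. \<Sum>j=1..m-i.
          (-1) ^ (i + j) * Li (m + 2 - i - j) (b * x) * Li2 (i + j) p x a)
     + (-1) ^ p * real p * ln (1 - a * x)
         * (Li2 (p + 1) m x b - Li2 (p + 1) m (inverse a) b)
     - (-1) ^ m * real m * ln (1 - b * x)
         * (Li2 (m + 1) p x a - Li2 (m + 1) p (inverse b) a)
     - (-1) ^ p * real p * (\<Sum>n. zeta_sum (Suc n) 1 (a * x) * zeta_sum (Suc n) m b
                        / (a ^ Suc n * real (Suc n) ^ (p + 1)))
     + (-1) ^ m * real m * (\<Sum>n. zeta_sum (Suc n) 1 (b * x) * zeta_sum (Suc n) p a
                        / (b ^ Suc n * real (Suc n) ^ (m + 1)))
     + (-1) ^ p * Li 2 (a * x) * Li2 p m (inverse a) b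
     - (-1) ^ m * Li 2 (b * x) * Li2 m p (inverse b) a"
proof -
  have sides: "\<bar>b\<bar> = \<bar>a\<bar>" "\<bar>b\<bar> > 1" "\<bar>x\<bar> < inverse \<bar>b\<bar>"
    using assms(3-5) by simp_all
  \<comment> \<open>The reduction is applied to \<open>(a, p)\<close> and, with roles exchanged, to
    \<open>(b, m)\<close>; the two triple sums agree by the swap and cancel in the
    difference.\<close>
  show ?thesis
    unfolding zeta_sum_series_reduction[OF assms(2,1,3-5)]
      zeta_sum_series_reduction[OF assms(1,2) sides]
      infsum_triple_term_swap[of x p a m b]
    by simp
qed
end
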